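(* Let $n\ge 1$. For any (nonzero) complex character $\chi$ of the symmetric group $S_n$, the symbol $(\mathfrak a(\chi)\mid\mathfrak b(\chi))$ defined in the context requires at most $n$ values $\chi(g)$. That is, there is a deterministic adaptive procedure which, for every nonzero character $\chi$ of $S_n$, queries the values of $\chi$ at no more than $n$ conjugacy classes of $S_n$ (each queried class being allowed to depend on the previously obtained values) and from the obtained values computes $(\mathfrak a(\chi)\mid \mathfrak b(\chi))$.
   Context: Convention. If $\nu=(\nu_1,\dots,\nu_l)$ is a partition of some $m\le n$ and $\chi$ is a character of $S_n$, then $\chi([\nu_1,\dots,\nu_l])$ is the value of $\chi$ on permutations of cycle type $(\nu_1,\dots,\nu_l,1,\dots,1)$ with $n-m$ appended $1$'s. For sequences $a,b$ of equal length, $(a\mid b)$ denotes the symbol formed by the pair. Definition of $\mathfrak h(\chi)$ and $\mathfrak d(\chi)$. For any (nonzero) character $\chi$ of $S_n$, define sequences $\mathfrak h(\chi)=(\mathfrak h_1,\dots,\mathfrak h_{\mathfrak k})$ and $\mathfrak d(\chi)=(\mathfrak d_1,\dots,\mathfrak d_{\mathfrak k+1})$, with $\mathfrak k=\mathfrak k(\chi)$, recursively: 1) $\mathfrak d_1=\chi(1)$; $\mathfrak h_1$ is the first element of the sequence $n,n-1,\dots,1$ with $\chi([\mathfrak h_1])\ne 0$; $\mathfrak d_2=\chi([\mathfrak h_1])$. 2) Given $\mathfrak h_1,\dots,\mathfrak h_{u-1}$ and $\mathfrak d_1,\dots,\mathfrak d_u$ with $u\ge 2$: (a) if $\sum_{i=1}^{u-1}\mathfrak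 h_i=n$ or $\mathfrak h_{u-1}\le 2$, then $\mathfrak k=u-1$ and the process stops; (b) if $\sum_{i=1}^{u-1}\mathfrak h_i<n$ and $\mathfrak h_{u-1}>2$, put $n_u=\min\{\mathfrak h_{u-1}-2,\ n-\sum_{i=1}^{u-1}\mathfrak h_i\}$, let $\mathfrak h_u$ be the first element of $n_u,n_u-1,\dots,1$ with $\chi([\mathfrak h_1,\dots,\mathfrak h_u])\neq 0$, and let $\mathfrak d_{u+1}=\chi([\mathfrak h_1,\dots,\mathfrak h_u])$. Definition of $\mathfrak c(\chi)$. For $i=1,\dots,\mathfrak k$, $$\mathfrak c_i=\frac{\binom{n-\sum_{j=1}^{i-1}\mathfrak h_j}{2}\,\chi([\mathfrak h_1,\dots,\mathfrak h_{i-1},2])}{\mathfrak d_i},$$ with the convention $\mathfrak c_{\mathfrak k}=0$ if $\mathfrak h_{\mathfrak k}=1$. Definition of the symbol. With $\binom{x}{2}=x(x-1)/2$, define $\mathfrak a(\chi)=(\mathfrak a_1,\dots,\mathfrak a_{\mathfrak k})$ (rational numbers) by $\mathfrak a_{\mathfrak k}=\frac{1}{\mathfrak h_{\mathfrak k}}\left(\mathfrak c_{\mathfrak k}+\binom{\mathfrak h_{\mathfrak k}}{2}\right)$ and, for $i=\mathfrak k-1,\mathfrak k-2,\dots,1$, $$\mathfrak a_i=\mathfrak a_{i+1}+\frac{1}{\mathfrak h_i}\left[\mathfrak c_i-\mathfrak c_{i+1}-\binom{\mathfrak a_{i+1}+1}{2}+\binom{\mathfrak h_{i+1}-\mathfrak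 a_{i+1}}{2}+\binom{\mathfrak h_i-\mathfrak h_{i+1}+1}{2}+(\mathfrak h_{i+1}-\mathfrak a_{i+1}-1)(\mathfrak h_i-\mathfrak h_{i+1})\right].$$ Define $\mathfrak b(\chi)=(\mathfrak b_1,\dots,\mathfrak b_{\mathfrak k})$ by $\mathfrak b_i=\mathfrak h_i-\mathfrak a_i-1$. *)

theory Defs
  imports Complex_Main "HOL-Library.Multiset" "HOL-Combinatorics.Orbits"
    "HOL-Algebra.Sym_Groups" "HOL-Algebra.Group_Action" "Jordan_Normal_Form.Matrix"
begin

section \<open>Characters of the symmetric group\<close>

definition mat_trace :: "complex mat \<Rightarrow> complex" where
  "mat_trace A = (\<Sum>i<dim_row A. A $$ (i, i))"

text \<open>
  A complex matrix representation of degree \<open>d\<close> is a group homomorphism into \<open>GL\<^sub>d(\<complex>)\<close>, here the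
  group of units of the matrix ring. Degree 0 is allowed and yields the zero character. Characters
  are total functions on \<open>nat \<Rightarrow> nat\<close>; their values outside of \<open>S\<^sub>n\<close> are irrelevant.
\<close>
definition is_character :: "nat \<Rightarrow> ((nat \<Rightarrow> nat) \<Rightarrow> complex) \<Rightarrow> bool" where
  "is_character n \<chi> \<longleftrightarrow>
     (\<exists>d \<rho>. \<rho> \<in> hom (sym_group n) (units_of (ring_mat TYPE(complex) d ())) \<and>
            (\<forall>g \<in> carrier (sym_group n). \<chi> g = mat_trace (\<rho> g)))"

definition nonzero_character :: "nat \<Rightarrow> ((nat \<Rightarrow> nat) \<Rightarrow> complex) \<Rightarrow> bool" where
  "nonzero_character n \<chi> \<longleftrightarrow> is_character n \<chi> \<and> (\<exists>g \<in> carrier (sym_group n). \<chi> g \<noteq> 0)"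

definition conj_classes :: "nat \<Rightarrow> (nat \<Rightarrow> nat) set set" where
  "conj_classes n =
     orbits (sym_group n) (carrier (sym_group n))
       (\<lambda>g. \<lambda>h \<in> carrier (sym_group n).
          g \<otimes>\<^bsub>sym_group n\<^esub> h \<otimes>\<^bsub>sym_group n\<^esub> inv\<^bsub>sym_group n\<^esub> g)"

text \<open>
  The choice of the representative does not matter, as characters are constant on conjugacy classes.
\<close>
definition class_value :: "((nat \<Rightarrow> nat) \<Rightarrow> complex) \<Rightarrow> (nat \<Rightarrow> nat) set \<Rightarrow> complex" where
  "class_value \<chi> C = \<chi> (SOME g. g \<in> C)"

text \<open>
  Cycle lengths of a permutation of \<open>{1..n}\<close>, fixed points included (as cycles of length 1).
\<close>
definition cycle_type :: "nat \<Rightarrow> (nat \<Rightarrow> nat) \<Rightarrow> nat multiset" where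
  "cycle_type n p = image_mset card (mset_set ((\<lambda>x. Orbits.orbit p x) ` {1..n}))"

text \<open>
  \<open>char_val n \<chi> \<nu>\<close> is \<open>\<chi>([\<nu>\<^sub>1, \<dots>, \<nu>\<^sub>l])\<close>, the value of \<open>\<chi>\<close> on permutations whose cycle type is
  \<open>\<nu>\<close> padded with 1s. It is meant for lists of positive numbers of sum at most \<open>n\<close>; then such
  permutations exist, and they are all conjugate, so that the choice does not matter for
  characters.
\<close>
definition char_val :: "nat \<Rightarrow> ((nat \<Rightarrow> nat) \<Rightarrow> complex) \<Rightarrow> nat list \<Rightarrow> complex" where
  "char_val n \<chi> \<nu> =
     \<chi> (SOME p. p \<in> carrier (sym_group n) \<and>
               cycle_type n p = mset \<nu> + replicate_mset (n - sum_list \<nu>) 1)"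


section \<open>The sequences \<open>\<hh>\<close>, \<open>\<dd>\<close>, \<open>\<cc>\<close>\<close>

text \<open>
  The list argument \<open>hs\<close> is \<open>[\<hh>\<^sub>1, \<dots>, \<hh>\<^sub>u\<^sub>-\<^sub>1]\<close>. The empty list stands for \<open>u = 1\<close>, where the
  search starts at \<open>n\<close> and the stopping condition is not tested.
\<close>
definition h_stop :: "nat \<Rightarrow> nat list \<Rightarrow> bool" where
  "h_stop n hs \<longleftrightarrow> hs \<noteq> [] \<and> (sum_list hs = n \<or> last hs \<le> 2)"

definition h_start :: "nat \<Rightarrow> nat list \<Rightarrow> nat" where
  "h_start n hs = (if hs = [] then n else min (last hs - 2) (n - sum_list hs))"

text \<open>
  For nonzero characters the search for the next entry never fails, because it ends at \<open>1\<close>,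
  where the value is the previous (nonzero) entry of \<open>\<dd>\<close>; the case \<open>None\<close> below only makes the
  function total.
\<close>
function h_from :: "nat \<Rightarrow> ((nat \<Rightarrow> nat) \<Rightarrow> complex) \<Rightarrow> nat list \<Rightarrow> nat list" where
  "h_from n \<chi> hs =
     (if h_stop n hs then hs
      else case find (\<lambda>h. char_val n \<chi> (hs @ [h]) \<noteq> 0) (rev [1..<Suc (h_start n hs)]) of
             None \<Rightarrow> hs
           | Some h \<Rightarrow> h_from n \<chi> (hs @ [h]))"
  by pat_completeness auto
termination
proof (relation "measure (\<lambda>(n, \<chi>, hs). n - sum_list hs)", goal_cases)
  case (2 n \<chi> hs h)
  from 2(2) have "h \<in> set (rev [1..<Suc (h_start n hs)])"
    by (metis find_Some_iff nth_mem)
  then have "1 \<le> h" "h \<le> h_start n hs"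
    by auto
  moreover have "h_start n hs \<le> n - sum_list hs"
    by (cases "hs = []") (simp_all add: h_start_def)
  ultimately show ?case
    by simp
qed simp

declare h_from.simps [simp del]

definition h_seq :: "nat \<Rightarrow> ((nat \<Rightarrow> nat) \<Rightarrow> complex) \<Rightarrow> nat list" where
  "h_seq n \<chi> = h_from n \<chi> []"

text \<open>
  Lists are indexed from 0, so \<open>\<hh>\<^sub>i\<close>, \<open>\<dd>\<^sub>i\<close>, \<open>\<cc>\<^sub>i\<close> are the entries at position \<open>i - 1\<close>.
\<close>
definition d_seq :: "nat \<Rightarrow> ((nat \<Rightarrow> nat) \<Rightarrow> complex) \<Rightarrow> complex list" where
  "d_seq n \<chi> = map (\<lambda>u. char_val n \<chi> (take u (h_seq n \<chi>))) [0..<Suc (length (h_seq n \<chi>))]"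

definition binom2 :: "complex \<Rightarrow> complex" where
  "binom2 x = x * (x - 1) / 2"

definition c_seq :: "nat \<Rightarrow> ((nat \<Rightarrow> nat) \<Rightarrow> complex) \<Rightarrow> complex list" where
  "c_seq n \<chi> =
     (let hs = h_seq n \<chi>; k = length hs in
      map (\<lambda>i. if Suc i = k \<and> hs ! i = 1 then 0
               else binom2 (of_nat n - of_nat (sum_list (take i hs))) *
                    char_val n \<chi> (take i hs @ [2]) / d_seq n \<chi> ! i)
        [0..<k])"


section \<open>The symbol\<close>

text \<open>The argument is the list of the pairs \<open>(\<hh>\<^sub>i, \<cc>\<^sub>i)\<close>.\<close>
fun a_rec :: "(complex \<times> complex) list \<Rightarrow> complex list" where
  "a_rec [] = []"
| "a_rec [(h, c)] = [1 / h * (c + binom2 h)]"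
| "a_rec ((h, c) # (h', c') # xs) =
     (let as = a_rec ((h', c') # xs); a' = hd as in
      (a' + 1 / h * (c - c' - binom2 (a' + 1) + binom2 (h' - a') + binom2 (h - h' + 1)
                      + (h' - a' - 1) * (h - h'))) # as)"

definition a_seq :: "nat \<Rightarrow> ((nat \<Rightarrow> nat) \<Rightarrow> complex) \<Rightarrow> complex list" where
  "a_seq n \<chi> = a_rec (zip (map of_nat (h_seq n \<chi>)) (c_seq n \<chi>))"

definition b_seq :: "nat \<Rightarrow> ((nat \<Rightarrow> nat) \<Rightarrow> complex) \<Rightarrow> complex list" where
  "b_seq n \<chi> = map2 (\<lambda>h a. of_nat h - a - 1) (h_seq n \<chi>) (a_seq n \<chi>)"

definition char_symbol :: "nat \<Rightarrow> ((nat \<Rightarrow> nat) \<Rightarrow> complex) \<Rightarrow> complex list \<times> complex list" where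
  "char_symbol n \<chi> = (a_seq n \<chi>, b_seq n \<chi>)"


section \<open>Deterministic adaptive query procedures\<close>

text \<open>
  Decision trees: \<open>Query q k\<close> asks for the value at \<open>q\<close> and continues with \<open>k\<close> applied to the
  answer. The procedure has no other access to the queried function.
\<close>
datatype ('q, 'v, 'r) procedure =
    Output 'r
  | Query 'q "'v \<Rightarrow> ('q, 'v, 'r) procedure"

primrec result :: "('q, 'v, 'r) procedure \<Rightarrow> ('q \<Rightarrow> 'v) \<Rightarrow> 'r" where
  "result (Output r) = (\<lambda>f. r)"
| "result (Query q k) = (\<lambda>f. result (k (f q)) f)"

primrec queries :: "('q, 'v, 'r) procedure \<Rightarrow> ('q \<Rightarrow> 'v) \<Rightarrow> 'q list" where
  "queries (Output r) = (\<lambda>f. [])"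
| "queries (Query q k) = (\<lambda>f. q # queries (k (f q)) f)"

end

theory Submission
  imports Defs
begin

text \<open>
  Apart from \<open>\<chi>(1)\<close>, two kinds of values enter the symbol: those inspected by the search for the
  entries \<open>\<hh>\<^sub>u\<close>, and the values \<open>\<chi>([\<hh>\<^sub>1, \<dots>, \<hh>\<^sub>u\<^sub>-\<^sub>1, 2])\<close> in the entries \<open>\<cc>\<^sub>u\<close>. The claim is that a
  search for \<open>\<hh>\<^sub>u\<close> that starts at \<open>h\<close>, together with everything after it, costs at most \<open>h - 1\<close>
  queries (\<open>length_queries_search\<close>).

  The candidate \<open>1\<close> is free, because appending a fixed point to a cycle type changes nothing: its
  value is the already known \<open>\<dd>\<^sub>u\<close> (\<open>char_val_snoc_1\<close>). So a search without success costs one query for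
  each of \<open>h, \<dots>, 2\<close>. If it succeeds at \<open>2\<close>, the value needed for \<open>\<cc>\<^sub>u\<close> is the one just seen, and
  if it reaches \<open>1\<close>, then \<open>\<cc>\<^sub>u = 0\<close> by convention; in both cases the process ends within the budget.
  If it succeeds at some \<open>\<hh>\<^sub>u \<ge> 3\<close>, one extra query is spent on \<open>\<cc>\<^sub>u\<close>, but the next search starts at
  \<open>\<hh>\<^sub>u - 2\<close> or below: the skipped candidate \<open>\<hh>\<^sub>u - 1\<close> pays for the extra query. As the first search
  starts at \<open>n\<close>, the total including \<open>\<chi>(1)\<close> is at most \<open>1 + (n - 1) = n\<close>.

  The procedure is first written with queries for cycle types, given as lists of naturals. Every
  list that it asks for is the cycle type of a permutation once it is padded with fixed points
  (\<open>perm_of_type_in_carrier\<close>), and characters are class functions (\<open>character_conjugate\<close>), so each such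
  query can be replaced by the query of a conjugacy class.
\<close>

section \<open>The search procedure and its cost\<close>

definition c_entry :: "nat \<Rightarrow> (nat list \<Rightarrow> complex) \<Rightarrow> nat list \<Rightarrow> nat \<Rightarrow> complex" where
  "c_entry n f hs h =
     (if h = 1 then 0
      else binom2 (of_nat n - of_nat (sum_list hs)) * f (hs @ [2]) / f hs)"

definition c_list :: "nat \<Rightarrow> (nat list \<Rightarrow> complex) \<Rightarrow> nat list \<Rightarrow> complex list" where
  "c_list n f hs = map (\<lambda>i. c_entry n f (take i hs) (hs ! i)) [0..<length hs]"

lemma c_list_snoc: "c_list n f (hs @ [h]) = c_list n f hs @ [c_entry n f hs h]"
  by (simp add: c_list_def nth_append)

text \<open>
  The arguments \<open>hs\<close>, \<open>cs\<close> and \<open>d\<close> hold \<open>[\<hh>\<^sub>1, \<dots>, \<hh>\<^sub>u\<^sub>-\<^sub>1]\<close>, \<open>[\<cc>\<^sub>1, \<dots>, \<cc>\<^sub>u\<^sub>-\<^sub>1]\<close> and \<open>\<dd>\<^sub>u\<close>, and \<open>h\<close> is the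
  next candidate for \<open>\<hh>\<^sub>u\<close>. The candidate \<open>1\<close> is judged by \<open>d\<close>, and the answer at \<open>hs @ [2]\<close> serves
  both the test of the candidate \<open>2\<close> and the entry \<open>\<cc>\<^sub>u\<close>.
\<close>
function search ::
  "nat \<Rightarrow> nat list \<Rightarrow> complex list \<Rightarrow> complex \<Rightarrow> nat
    \<Rightarrow> (nat list, complex, nat list \<times> complex list) procedure" where
  "search n hs cs d h =
     (if h = 0 then Output (hs, cs)
      else if h = 1 then (if d = 0 then Output (hs, cs) else Output (hs @ [1], cs @ [0]))
      else Query (hs @ [h]) (\<lambda>v.
        if v = 0 then search n hs cs d (h - 1)
        else let c = (\<lambda>w. binom2 (of_nat n - of_nat (sum_list hs)) * w / d) in
          if h = 2 then Output (hs @ [2], cs @ [c v])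
          else Query (hs @ [2]) (\<lambda>w.
            if sum_list (hs @ [h]) = n then Output (hs @ [h], cs @ [c w])
            else search n (hs @ [h]) (cs @ [c w]) v (h_start n (hs @ [h])))))"
  by pat_completeness auto
termination
  by (relation "measure (\<lambda>(n, hs, cs, d, h). h)") (auto simp: h_start_def)

declare search.simps [simp del]

text \<open>
  The bound holds for arbitrary answers. A zero answer pays for passing from \<open>h\<close> to \<open>h - 1\<close>; a
  nonzero answer at \<open>h \<ge> 3\<close> accounts for two queries, followed if at all by a search that starts at
  \<open>h - 2\<close> or below.
\<close>
lemma length_queries_search: "length (queries (search n hs cs d h) f) \<le> h - 1"
proof (induction n hs cs d h rule: search.induct)
  case (1 n hs cs d h)
  show ?case
  proof (cases "h \<le> 1")
    case False
    have miss: "length (queries (search n hs cs d (h - 1)) f) \<le> h - 2" if "f (hs @ [h]) = 0"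
      using "1.IH"(1)[of "f (hs @ [h])"] False that by simp
    have hit: "length (queries (search n (hs @ [h])
        (cs @ [binom2 (of_nat n - of_nat (sum_list hs)) * f (hs @ [2]) / d])
        (f (hs @ [h])) (h_start n (hs @ [h]))) f) + 2 \<le> h - 1"
      (is "?l + 2 \<le> _")
      if "h \<noteq> 2" "f (hs @ [h]) \<noteq> 0" "sum_list hs + h \<noteq> n"
    proof -
      have "?l \<le> h_start n (hs @ [h]) - 1"
        using "1.IH"(2)[of "f (hs @ [h])" _ "f (hs @ [2])", OF _ _ _ refl] False that by simp
      also have "\<dots> \<le> h - 3"
        by (simp add: h_start_def)
      finally show ?thesis using False \<open>h \<noteq> 2\<close> by simp
    qed
    show ?thesis
      unfolding search.simps[of n hs cs d h] using False miss hit by (auto simp: Let_def)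
  qed (auto simp: search.simps)
qed

lemma set_queries_search:
  assumes "0 \<notin> set hs" "sum_list hs + h \<le> n"
  shows "set (queries (search n hs cs d h) f) \<subseteq> {\<nu>. 0 \<notin> set \<nu> \<and> sum_list \<nu> \<le> n}"
  using assms
proof (induction n hs cs d h rule: search.induct)
  case (1 n hs cs d h)
  show ?case
  proof (cases "h \<le> 1")
    case False
    have *: "sum_list (hs @ [h]) + h_start n (hs @ [h]) \<le> n"
      using 1 by (simp add: h_start_def)
    show ?thesis
      using 1 * False by (subst search.simps) (auto simp: Let_def)
  qed (auto simp: search.simps)
qed

section \<open>Correctness of the search\<close>

lemma h_from_stop: "h_stop n hs \<Longrightarrow> h_from n \<chi> hs = hs"
  by (simp add: h_from.simps)

text \<open>Both sides evaluate \<open>\<chi>\<close> at a permutation of the same padded cycle type.\<close>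
lemma char_val_snoc_1:
  assumes "sum_list \<nu> < n"
  shows "char_val n \<chi> (\<nu> @ [1]) = char_val n \<chi> \<nu>"
proof -
  have "n - sum_list \<nu> = Suc (n - sum_list (\<nu> @ [1]))"
    using assms by simp
  then have "mset (\<nu> @ [1]) + replicate_mset (n - sum_list (\<nu> @ [1])) 1
      = mset \<nu> + replicate_mset (n - sum_list \<nu>) 1"
    by simp
  then show ?thesis
    by (simp only: char_val_def)
qed

text \<open>
  The right-hand side is the unfolding of the recursion for \<open>\<hh>(\<chi>)\<close> at a search whose candidates
  above \<open>h\<close> have been rejected already. With \<open>h = h_start n hs\<close> its first component is
  \<open>h_from n \<chi> hs\<close>, provided that the process does not stop at \<open>hs\<close>.
\<close>
lemma result_search:
  assumes "sum_list hs + h \<le> n"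
    and "cs = c_list n (char_val n \<chi>) hs" "d = char_val n \<chi> hs"
  shows "result (search n hs cs d h) (char_val n \<chi>) =
    (let hs' = (case find (\<lambda>h. char_val n \<chi> (hs @ [h]) \<noteq> 0) (rev [1..<Suc h]) of
                  None \<Rightarrow> hs
                | Some h \<Rightarrow> h_from n \<chi> (hs @ [h]))
     in (hs', c_list n (char_val n \<chi>) hs'))"
  using assms
proof (induction n hs cs d h rule: search.induct)
  case (1 n hs cs d h)
  let ?f = "char_val n \<chi>"
  consider "h = 0" | "h = 1" | "h = 2" "?f (hs @ [h]) \<noteq> 0" | "h \<ge> 2" "?f (hs @ [h]) = 0"
    | "h > 2" "?f (hs @ [h]) \<noteq> 0" by linarith
  moreover have find: "find (\<lambda>h. ?f (hs @ [h]) \<noteq> 0) (rev [1..<Suc h]) = Some h"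
    if "h \<ge> 2" "?f (hs @ [h]) \<noteq> 0"
    using that by simp
  ultimately show ?case
  proof cases
    case 1
    then show ?thesis using "1.prems" by (simp add: search.simps)
  next
    case 2
    then have "?f (hs @ [1]) = d"
      using "1.prems" by (simp add: char_val_snoc_1 del: One_nat_def)
    moreover have "h_stop n (hs @ [1])"
      by (simp add: h_stop_def)
    ultimately show ?thesis
      using 2 "1.prems" by (simp add: search.simps h_from_stop c_list_snoc c_entry_def)
  next
    case 3
    then have "h_stop n (hs @ [2])"
      by (simp add: h_stop_def)
    moreover have "result (search n hs cs d h) ?f = (hs @ [2], c_list n ?f (hs @ [2]))"
      unfolding search.simps[of n hs cs d h] using 3 "1.prems"
      by (simp add: Let_def c_list_snoc c_entry_def)
    ultimately show ?thesis
      using 3 find by (simp add: Let_def h_from_stop del: upt_Suc)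
  next
    case 4
    then have "result (search n hs cs d h) ?f = result (search n hs cs d (h - 1)) ?f"
      by (simp add: search.simps[of n hs cs d h])
    moreover have "find (\<lambda>h. ?f (hs @ [h]) \<noteq> 0) (rev [1..<Suc h])
        = find (\<lambda>h. ?f (hs @ [h]) \<noteq> 0) (rev [1..<Suc (h - 1)])"
      using 4 by simp
    ultimately show ?thesis
      using 4 "1.IH"(1)[of 0] "1.prems" by (simp del: upt_Suc)
  next
    case 5
    define hs' where "hs' = hs @ [h]"
    define cs' where "cs' = c_list n ?f hs'"
    have cs': "cs @ [binom2 (of_nat n - of_nat (sum_list hs)) * ?f (hs @ [2]) / d] = cs'"
      using 5 "1.prems" by (simp add: cs'_def hs'_def c_list_snoc c_entry_def)
    note find = find[OF less_imp_le[OF 5(1)] 5(2)]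
    have step: "result (search n hs cs d h) ?f =
        (if sum_list hs' = n then (hs', cs')
         else result (search n hs' cs' (?f hs') (h_start n hs')) ?f)"
      using 5 by (simp add: search.simps[of n hs cs d h] Let_def cs' hs'_def)
    show ?thesis
    proof (cases "sum_list hs' = n")
      case True
      then have "h_stop n hs'"
        by (simp add: h_stop_def hs'_def)
      then show ?thesis
        unfolding step find using True by (simp add: Let_def h_from_stop cs'_def hs'_def)
    next
      case False
      have ns: "\<not> h_stop n hs'"
        using False 5 by (simp add: h_stop_def hs'_def)
      have "sum_list hs' + h_start n hs' \<le> n"
        using "1.prems" by (simp add: h_start_def hs'_def)
      moreover have "h \<noteq> 0" "h \<noteq> 1" "h \<noteq> 2" using 5 by auto
      ultimately have "result (search n hs' cs' (?f hs') (h_start n hs')) ?f =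
        (let hs'' = (case find (\<lambda>h. ?f (hs' @ [h]) \<noteq> 0) (rev [1..<Suc (h_start n hs')]) of
                  None \<Rightarrow> hs'
                | Some h \<Rightarrow> h_from n \<chi> (hs' @ [h]))
         in (hs'', c_list n ?f hs''))"
        using "1.IH"(2)[of "?f hs'" _ "?f (hs @ [2])", OF _ _ _ refl] 5 False cs'
        unfolding hs'_def cs'_def by (simp add: Let_def del: upt_Suc append_assoc)
      also have "\<dots> = (h_from n \<chi> hs', c_list n ?f (h_from n \<chi> hs'))"
        using ns by (simp add: h_from.simps[of n \<chi> hs'] Let_def)
      finally show ?thesis
        unfolding step find using False by (simp add: Let_def hs'_def)
    qed
  qed
qed

definition compute_symbol :: "nat \<Rightarrow> (nat list, complex, nat list \<times> complex list) procedure" where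
  "compute_symbol n = Query [] (\<lambda>d. search n [] [] d n)"

text \<open>
  The process stops after an entry at most \<open>2\<close>. Hence an entry \<open>1\<close> can only be the last one, and
  \<open>c_list\<close>, which assigns \<open>0\<close> to every entry \<open>1\<close>, agrees with the convention for \<open>\<cc>(\<chi>)\<close>.
\<close>
lemma butlast_h_from:
  assumes "\<forall>h \<in> set hs. 2 < h"
  shows "\<forall>h \<in> set (butlast (h_from n \<chi> hs)). 2 < h"
  using assms
proof (induction n \<chi> hs rule: h_from.induct)
  case (1 n \<chi> hs)
  show ?case
  proof (cases "h_stop n hs")
    case True
    with "1.prems" show ?thesis
      by (auto simp: h_from_stop dest: in_set_butlastD)
  next
    case False
    show ?thesis
    proof (cases "find (\<lambda>h. char_val n \<chi> (hs @ [h]) \<noteq> 0) (rev [1..<Suc (h_start n hs)])")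
      case None
      with False "1.prems" show ?thesis
        by (subst h_from.simps) (auto dest: in_set_butlastD)
    next
      case (Some h)
      have eq: "h_from n \<chi> hs = h_from n \<chi> (hs @ [h])"
        using False Some by (subst h_from.simps) simp
      show ?thesis
      proof (cases "2 < h")
        case True
        with "1.IH"[OF False Some] "1.prems" eq show ?thesis by simp
      next
        case False
        then have "h_stop n (hs @ [h])"
          by (simp add: h_stop_def)
        with "1.prems" eq show ?thesis by (simp add: h_from_stop)
      qed
    qed
  qed
qed

lemma c_seq_eq_c_list: "c_seq n \<chi> = c_list n (char_val n \<chi>) (h_seq n \<chi>)"
proof -
  have *: "Suc i = length (h_seq n \<chi>)" if "i < length (h_seq n \<chi>)" "h_seq n \<chi> ! i = 1" for i
  proof (rule ccontr)
    assume "Suc i \<noteq> length (h_seq n \<chi>)"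
    with that have "1 \<in> set (butlast (h_seq n \<chi>))"
      by (metis Suc_lessI in_set_conv_nth length_butlast less_diff_conv nth_butlast Suc_eq_plus1)
    with butlast_h_from[of "[]" n \<chi>] show False
      by (auto simp: h_seq_def)
  qed
  show ?thesis
    unfolding c_seq_def c_list_def c_entry_def d_seq_def Let_def
    by (intro map_cong refl) (use * in \<open>auto simp del: upt_Suc\<close>)
qed

definition symbol_from :: "nat list \<times> complex list \<Rightarrow> complex list \<times> complex list" where
  "symbol_from = (\<lambda>(hs, cs).
     let as = a_rec (zip (map of_nat hs) cs) in (as, map2 (\<lambda>h a. of_nat h - a - 1) hs as))"

lemma char_symbol_eq: "char_symbol n \<chi> = symbol_from (h_seq n \<chi>, c_seq n \<chi>)"
  by (simp add: char_symbol_def symbol_from_def a_seq_def b_seq_def Let_def)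

lemma result_compute_symbol:
  assumes "n \<ge> 1"
  shows "result (compute_symbol n) (char_val n \<chi>) = (h_seq n \<chi>, c_seq n \<chi>)"
proof -
  have "h_from n \<chi> [] =
    (case find (\<lambda>h. char_val n \<chi> ([] @ [h]) \<noteq> 0) (rev [1..<Suc n]) of
       None \<Rightarrow> [] | Some h \<Rightarrow> h_from n \<chi> ([] @ [h]))"
    by (subst h_from.simps) (simp add: h_stop_def h_start_def)
  then show ?thesis
    by (simp add: compute_symbol_def result_search c_list_def h_seq_def c_seq_eq_c_list Let_def
        del: upt_Suc)
qed

section \<open>Permutations of a given cycle type\<close>

text \<open>For \<open>p\<close> in \<open>S\<^sub>n\<close>, the product of \<open>p\<close> with the cycle \<open>(n+1 \<dots> n+l)\<close>.\<close>
definition append_cycle :: "(nat \<Rightarrow> nat) \<Rightarrow> nat \<Rightarrow> nat \<Rightarrow> nat \<Rightarrow> nat" where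
  "append_cycle p n l x =
     (if x \<le> n then p x else if x < n + l then Suc x else if x = n + l then Suc n else x)"

lemma append_cycle_permutes:
  assumes p: "p permutes {1..n}" and l: "l \<noteq> 0"
  shows "append_cycle p n l permutes {1..n + l}"
proof (rule bij_imp_permutes)
  have p_le: "p x \<le> n \<and> (1 \<le> x \<longrightarrow> 1 \<le> p x)" if "x \<le> n" for x
    using permutes_in_image[OF p, of x] permutes_not_in[OF p, of x] that by (cases "x = 0") auto
  have sub: "append_cycle p n l ` {1..n + l} \<subseteq> {1..n + l}"
  proof (rule image_subsetI)
    fix x assume "x \<in> {1..n + l}"
    with p_le[of x] l show "append_cycle p n l x \<in> {1..n + l}"
      by (cases "x \<le> n") (auto simp: append_cycle_def)
  qed
  moreover have inj: "inj_on (append_cycle p n l) {1..n + l}"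
  proof (rule inj_onI)
    fix x y
    assume "x \<in> {1..n + l}" "y \<in> {1..n + l}" "append_cycle p n l x = append_cycle p n l y"
    then show "x = y"
      using p_le[of x] p_le[of y] permutes_inj[OF p]
      by (auto simp: append_cycle_def dest: injD split: if_splits)
  qed
  ultimately show "bij_betw (append_cycle p n l) {1..n + l} {1..n + l}"
    by (simp add: bij_betw_def endo_inj_surj)
next
  fix x assume "x \<notin> {1..n + l}"
  with permutes_not_in[OF p, of x] show "append_cycle p n l x = x"
    by (auto simp: append_cycle_def)
qed

lemma cycle_type_append_cycle:
  assumes p: "p permutes {1..n}" and l: "l \<noteq> 0"
  shows "cycle_type (n + l) (append_cycle p n l) = add_mset l (cycle_type n p)"
proof -
  let ?q = "append_cycle p n l"
  \<comment> \<open>\<open>?q\<close> restricts to \<open>p\<close> on \<open>{1..n}\<close>, which it preserves, so the old cycles survive.\<close>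
  have orb_old: "Orbits.orbit ?q x = Orbits.orbit p x" if "x \<in> {1..n}" for x
  proof (rule orbit_cong0[of x "{1..n}"])
    show "?q \<in> {1..n} \<rightarrow> {1..n}"
      using permutes_in_image[OF p] by (auto simp: append_cycle_def)
  qed (use that in \<open>auto simp: append_cycle_def\<close>)
  have "Orbits.orbit p x \<subseteq> {1..n}" if "x \<in> {1..n}" for x
    using permutes_orbit_subset[OF p that] .
  moreover have orb_new: "Orbits.orbit ?q x = {Suc n..n + l}" if "x \<in> {Suc n..n + l}" for x
  proof
    show "Orbits.orbit ?q x \<subseteq> {Suc n..n + l}"
    proof
      fix y assume "y \<in> Orbits.orbit ?q x"
      then show "y \<in> {Suc n..n + l}"
        by induction (use that in \<open>auto simp: append_cycle_def\<close>)
    qed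
    \<comment> \<open>From \<open>x\<close> one climbs to \<open>n + l\<close>, wraps around to \<open>n + 1\<close> and climbs again.\<close>
    have up: "i \<in> Orbits.orbit ?q y" if "y < i" "y > n" "i \<le> n + l" for y i
      using that
    proof (induction i)
      case (Suc i)
      have "?q i = Suc i" using Suc.prems by (simp add: append_cycle_def)
      then show ?case
        using Suc by (metis less_Suc_eq less_or_eq_imp_le Suc_leD orbit.base orbit.step)
    qed simp
    have wrap: "?q (n + l) = Suc n"
      using l by (simp add: append_cycle_def)
    have "Suc n \<in> Orbits.orbit ?q x"
    proof (cases "x = n + l")
      case True
      then show ?thesis using orbit.base[of ?q x] wrap by simp
    next
      case False
      with up[of x "n + l"] that have "n + l \<in> Orbits.orbit ?q x" by auto
      from orbit.step[OF this] wrap show ?thesis by simp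
    qed
    then have "i \<in> Orbits.orbit ?q x" if "i \<in> {Suc n..n + l}" for i
      using up[of "Suc n" i] that orbit_trans[of i ?q "Suc n" x] by (cases "i = Suc n") auto
    then show "{Suc n..n + l} \<subseteq> Orbits.orbit ?q x" by blast
  qed
  have "{1..n + l} = {1..n} \<union> {Suc n..n + l}" by auto
  moreover have "(\<lambda>x. Orbits.orbit ?q x) ` {Suc n..n + l} = {{Suc n..n + l}}"
    using orb_new l by (auto simp: image_constant_conv cong: image_cong_simp)
  moreover have "(\<lambda>x. Orbits.orbit ?q x) ` {1..n} = (\<lambda>x. Orbits.orbit p x) ` {1..n}"
    using orb_old by (intro image_cong) auto
  ultimately have "(\<lambda>x. Orbits.orbit ?q x) ` {1..n + l}
      = insert {Suc n..n + l} ((\<lambda>x. Orbits.orbit p x) ` {1..n})"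
    by (simp add: image_Un)
  moreover have "{Suc n..n + l} \<notin> (\<lambda>x. Orbits.orbit p x) ` {1..n}"
    using \<open>\<And>x. x \<in> {1..n} \<Longrightarrow> Orbits.orbit p x \<subseteq> {1..n}\<close> l by fastforce
  ultimately show ?thesis
    by (simp add: cycle_type_def)
qed

lemma ex_permutation_of_cycle_type:
  assumes "0 \<notin> set ls"
  shows "\<exists>p. p permutes {1..sum_list ls} \<and> cycle_type (sum_list ls) p = mset ls"
  using assms
proof (induction ls)
  case Nil
  have "id permutes {1..0::nat} \<and> cycle_type 0 id = {#}"
    by (simp add: cycle_type_def permutes_id)
  then show ?case by auto
next
  case (Cons l ls)
  then obtain p where p: "p permutes {1..sum_list ls}" "cycle_type (sum_list ls) p = mset ls"
    by auto
  from append_cycle_permutes[OF p(1), of l] cycle_type_append_cycle[OF p(1), of l] p(2) Cons.prems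
  show ?case by (auto simp: add.commute)
qed

text \<open>
  This is the very permutation at which \<open>char_val\<close> evaluates a character, so that the class of
  \<open>perm_of_type n \<nu>\<close> is the one to query for \<open>char_val n \<chi> \<nu>\<close>.
\<close>
definition perm_of_type :: "nat \<Rightarrow> nat list \<Rightarrow> nat \<Rightarrow> nat" where
  "perm_of_type n \<nu> = (SOME p. p \<in> carrier (sym_group n) \<and>
     cycle_type n p = mset \<nu> + replicate_mset (n - sum_list \<nu>) 1)"

lemma perm_of_type_in_carrier:
  assumes "0 \<notin> set \<nu>" "sum_list \<nu> \<le> n"
  shows "perm_of_type n \<nu> \<in> carrier (sym_group n)"
proof -
  let ?ls = "\<nu> @ replicate (n - sum_list \<nu>) 1"
  have "\<exists>p. p permutes {1..sum_list ?ls} \<and> cycle_type (sum_list ?ls) p = mset ?ls"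
    using assms by (intro ex_permutation_of_cycle_type) auto
  moreover have "sum_list ?ls = n"
    using assms by (simp add: sum_list_replicate)
  ultimately have "\<exists>p. p \<in> carrier (sym_group n) \<and>
     cycle_type n p = mset \<nu> + replicate_mset (n - sum_list \<nu>) 1"
    by (simp add: sym_group_carrier)
  from someI_ex[OF this] show ?thesis
    by (simp add: perm_of_type_def)
qed

section \<open>Characters are class functions\<close>

lemma mat_trace_mult_commute:
  assumes "A \<in> carrier_mat d d" "B \<in> carrier_mat d d"
  shows "mat_trace (A * B) = mat_trace (B * A)"
proof -
  have "mat_trace (A * B) = (\<Sum>i<d. \<Sum>j<d. A $$ (i, j) * B $$ (j, i))"
    using assms by (auto simp: mat_trace_def scalar_prod_def lessThan_atLeast0 intro!: sum.cong)
  also have "\<dots> = (\<Sum>j<d. \<Sum>i<d. B $$ (j, i) * A $$ (i, j))"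
    by (subst sum.swap) (simp add: mult.commute)
  also have "\<dots> = mat_trace (B * A)"
    using assms by (auto simp: mat_trace_def scalar_prod_def lessThan_atLeast0 intro!: sum.cong)
  finally show ?thesis .
qed

text \<open>
  Writing \<open>k = h g\<^sup>-\<^sup>1\<close>, the two arguments are \<open>g k\<close> and \<open>k g\<close>, and a trace does not see the order
  of two factors.
\<close>
lemma character_conjugate:
  assumes \<chi>: "is_character n \<chi>"
    and g: "g \<in> carrier (sym_group n)" and h: "h \<in> carrier (sym_group n)"
  shows "\<chi> (g \<otimes>\<^bsub>sym_group n\<^esub> h \<otimes>\<^bsub>sym_group n\<^esub> inv\<^bsub>sym_group n\<^esub> g) = \<chi> h"
proof -
  interpret S: group "sym_group n" by (rule sym_group_is_group)
  from \<chi> obtain d \<rho> where \<rho>: "\<rho> \<in> hom (sym_group n) (units_of (ring_mat TYPE(complex) d ()))"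
    and tr: "\<And>x. x \<in> carrier (sym_group n) \<Longrightarrow> \<chi> x = mat_trace (\<rho> x)"
    unfolding is_character_def by blast
  have mult: "\<rho> (x \<otimes>\<^bsub>sym_group n\<^esub> y) = \<rho> x * \<rho> y"
    if "x \<in> carrier (sym_group n)" "y \<in> carrier (sym_group n)" for x y
    using hom_mult[OF \<rho> that] by (simp add: units_of_mult ring_mat_simps)
  have mat: "\<rho> x \<in> carrier_mat d d" if "x \<in> carrier (sym_group n)" for x
    using hom_in_carrier[OF \<rho> that] by (simp add: units_of_carrier Units_def ring_mat_simps)
  let ?k = "h \<otimes>\<^bsub>sym_group n\<^esub> inv\<^bsub>sym_group n\<^esub> g"
  have k: "?k \<in> carrier (sym_group n)" using g h by (intro S.m_closed S.inv_closed)
  have "\<chi> (g \<otimes>\<^bsub>sym_group n\<^esub> ?k) = mat_trace (\<rho> g * \<rho> ?k)"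
    using g k by (simp add: tr mult)
  also have "\<dots> = mat_trace (\<rho> ?k * \<rho> g)"
    using g k by (intro mat_trace_mult_commute[of _ d] mat)
  also have "\<dots> = \<chi> (?k \<otimes>\<^bsub>sym_group n\<^esub> g)"
    using g k by (simp add: tr mult)
  also have "?k \<otimes>\<^bsub>sym_group n\<^esub> g = h"
    using g h by (simp add: S.m_assoc del: sym_group_inv_equality)
  finally show ?thesis
    using g h by (simp add: S.m_assoc del: sym_group_inv_equality)
qed

definition conj_class :: "nat \<Rightarrow> (nat \<Rightarrow> nat) \<Rightarrow> (nat \<Rightarrow> nat) set" where
  "conj_class n = Group_Action.orbit (sym_group n)
     (\<lambda>g. \<lambda>h \<in> carrier (sym_group n).
        g \<otimes>\<^bsub>sym_group n\<^esub> h \<otimes>\<^bsub>sym_group n\<^esub> inv\<^bsub>sym_group n\<^esub> g)"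

lemma conj_class_in_conj_classes:
  "p \<in> carrier (sym_group n) \<Longrightarrow> conj_class n p \<in> conj_classes n"
  by (auto simp: conj_classes_def conj_class_def Group_Action.orbits_def)

lemma class_value_conj_class:
  assumes \<chi>: "is_character n \<chi>" and p: "p \<in> carrier (sym_group n)"
  shows "class_value \<chi> (conj_class n p) = \<chi> p"
proof -
  have eq: "conj_class n p = {g \<otimes>\<^bsub>sym_group n\<^esub> p \<otimes>\<^bsub>sym_group n\<^esub> inv\<^bsub>sym_group n\<^esub> g
      | g. g \<in> carrier (sym_group n)}"
    using p by (simp add: conj_class_def Group_Action.orbit_def)
  then have "conj_class n p \<noteq> {}"
    using p by auto
  then have "(SOME x. x \<in> conj_class n p) \<in> conj_class n p"
    by (simp add: some_in_eq)
  then show ?thesis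
    unfolding class_value_def using character_conjugate[OF \<chi> _ p] by (auto simp: eq)
qed

section \<open>Transfer to queries of conjugacy classes\<close>

lemma result_queries_map_procedure:
  "result (map_procedure q r P) f = r (result P (f \<circ> q)) \<and>
   queries (map_procedure q r P) f = map q (queries P (f \<circ> q))"
  by (induction P) auto

text \<open>A procedure depends on the queried function only through the answers that it receives.\<close>
lemma result_queries_cong:
  "(\<And>x. x \<in> set (queries P f) \<Longrightarrow> f x = g x) \<Longrightarrow> result P g = result P f \<and> queries P g = queries P f"
  by (induction P) auto

theorem proposition3p8:
  fixes n :: nat
  assumes "n \<ge> 1"
  shows "\<exists>P :: ((nat \<Rightarrow> nat) set, complex, complex list \<times> complex list) procedure.
           \<forall>\<chi>. nonzero_character n \<chi> \<longrightarrow>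
             set (queries P (class_value \<chi>)) \<subseteq> conj_classes n \<and>
             length (queries P (class_value \<chi>)) \<le> n \<and>
             result P (class_value \<chi>) = char_symbol n \<chi>"
proof (intro exI allI impI)
  fix \<chi> assume "nonzero_character n \<chi>"
  then have \<chi>: "is_character n \<chi>"
    by (simp add: nonzero_character_def)
  let ?class = "\<lambda>\<nu>. conj_class n (perm_of_type n \<nu>)"
  let ?P = "map_procedure ?class symbol_from (compute_symbol n)"
  let ?Q = "queries (compute_symbol n) (char_val n \<chi>)"
  have valid: "set ?Q \<subseteq> {\<nu>. 0 \<notin> set \<nu> \<and> sum_list \<nu> \<le> n}"
    using set_queries_search[of "[]" n n] by (auto simp: compute_symbol_def)
  have "char_val n \<chi> \<nu> = (class_value \<chi> \<circ> ?class) \<nu>" if "\<nu> \<in> set ?Q" for \<nu>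
  proof -
    have "perm_of_type n \<nu> \<in> carrier (sym_group n)"
      using valid that by (intro perm_of_type_in_carrier) auto
    then show ?thesis
      by (simp add: class_value_conj_class[OF \<chi>] char_val_def perm_of_type_def)
  qed
  from result_queries_cong[of "compute_symbol n" "char_val n \<chi>" "class_value \<chi> \<circ> ?class", OF this]
  have "queries ?P (class_value \<chi>) = map ?class ?Q"
    and "result ?P (class_value \<chi>) = symbol_from (result (compute_symbol n) (char_val n \<chi>))"
    by (simp_all add: result_queries_map_procedure)
  moreover have "length ?Q \<le> n"
    using length_queries_search[of n "[]" "[]" "char_val n \<chi> []" n "char_val n \<chi>"] assms
    by (simp add: compute_symbol_def)
  moreover have "?class \<nu> \<in> conj_classes n" if "\<nu> \<in> set ?Q" for \<nu>
    using valid that by (intro conj_class_in_conj_classes perm_of_type_in_carrier) auto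
  ultimately show "set (queries ?P (class_value \<chi>)) \<subseteq> conj_classes n \<and>
      length (queries ?P (class_value \<chi>)) \<le> n \<and>
      result ?P (class_value \<chi>) = char_symbol n \<chi>"
    using assms by (auto simp: result_compute_symbol char_symbol_eq)
qed

end
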